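(* Let $m\le n$. If all the zeros of a polynomial $f(z)$ of degree $n$ lie in $|z|\le r$ and if all the zeros of the polynomial $$g(z)=\lambda_0+\binom{n}{1}\lambda_1 z+\cdots+\binom{n}{m}\lambda_m z^m$$ lie in $|z|\le s|z-\sigma|$, $s>0$, then the polynomial $$h(z)=\lambda_0 f(z)+\lambda_1 f'(z)\frac{(\sigma z)}{1!}+\cdots+\lambda_m f^{(m)}(z)\frac{(\sigma z)^m}{m!}$$ has all its zeros in $|z|\le r\max(1,s)$.
   Context: Polynomials are in the complex variable $z$ with complex coefficients; $m,n$ are nonnegative integers, $\lambda_0,\ldots,\lambda_m$ and $\sigma$ are complex numbers, and $r,s$ are real numbers. $f^{(k)}$ denotes the $k$-th derivative of $f$.
   Formalization: The case where both σ = 0 and λ_0 = 0 is excluded: there h is the zero polynomial, so every z is a zero of h and the claim fails (e.g. n = m = 1, f = z, g = z, s = 1). *)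

theory Defs
  imports Complex_Main "HOL-Computational_Algebra.Polynomial"
begin

end

theory Submission
  imports Defs "HOL-Computational_Algebra.Fundamental_Theorem_Algebra"
begin

text \<open>
  Fix \<open>z\<close> and view the value \<open>h(z)\<close> as a functional of \<open>f\<close>.  It is symmetric in the zeros
  \<open>\<alpha>\<^sub>1, \<dots>, \<alpha>\<^sub>n\<close> of \<open>f\<close> and affine in each of them, so by Walsh's coincidence principle it
  can vanish only if it vanishes when all the \<open>\<alpha>\<^sub>i\<close> are replaced by one suitable point \<open>\<alpha>\<close> of the
  disc \<open>\<bar>\<alpha>\<bar> \<le> r\<close>.  For \<open>f = (x - \<alpha>)\<^sup>n\<close> the functional has the closed form
  \<open>(z - \<alpha>)\<^sup>n g (\<sigma> z / (z - \<alpha>))\<close>.  If \<open>\<bar>z\<bar> > r\<close>, then \<open>z \<noteq> \<alpha>\<close>, and a zero of this expression gives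
  the zero \<open>w = \<sigma> z / (z - \<alpha>)\<close> of \<open>g\<close>; as \<open>w - \<sigma> = \<sigma> \<alpha> / (z - \<alpha>)\<close>, the hypothesis
  \<open>\<bar>w\<bar> \<le> s \<bar>w - \<sigma>\<bar>\<close> says \<open>\<bar>z\<bar> \<le> s \<bar>\<alpha>\<bar> \<le> s r\<close> whenever \<open>\<sigma> \<noteq> 0\<close>.  If \<open>\<sigma> = 0\<close>, then
  \<open>w = 0\<close>, which is not a zero of \<open>g\<close> because \<open>g(0) = \<lambda>\<^sub>0 \<noteq> 0\<close>.

  The coincidence principle (\<open>walsh_coincidence\<close>) is proved by splitting off the zeros of \<open>f\<close> one
  at a time.  Removing one zero turns the polynomial that records the coincident case into
  its polar derivative, and \<open>laguerre_polar_derivative\<close> says that a polar derivative with pole in a disc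
  keeps the property of having no zeros in that disc.  Laguerre's theorem itself is a
  convexity argument: inversion at a point \<open>u\<close> of the disc maps the exterior of the disc, with infinity
  included, onto a convex set, and the logarithmic derivative at \<open>u\<close> is up to a factor an average of
  points of this set.
\<close>

section \<open>Laguerre's theorem on polar derivatives\<close>

text \<open>
  For \<open>y \<noteq> 0\<close> the condition \<open>\<rho> \<bar>y\<bar> < \<bar>1 + a y\<bar>\<close> says that \<open>a + 1 / y\<close> lies outside the disc of radius
  \<open>\<rho>\<close> about \<open>0\<close>.  When \<open>\<bar>a\<bar> \<le> \<rho>\<close> it describes a convex set: a disc, a half-plane
  or the whole plane (the quadratic part of
  \<open>\<bar>1 + a y\<bar>\<^sup>2 - \<rho>\<^sup>2 \<bar>y\<bar>\<^sup>2\<close> is \<open>(\<bar>a\<bar>\<^sup>2 - \<rho>\<^sup>2) \<bar>y\<bar>\<^sup>2\<close>, hence concave).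
\<close>
lemma inverted_exterior_convex:
  fixes a x y :: complex and \<rho> t :: real
  assumes a: "cmod a \<le> \<rho>" and t: "0 \<le> t" "t \<le> 1"
    and x: "\<rho> * cmod x < cmod (1 + a * x)"
    and y: "\<rho> * cmod y < cmod (1 + a * y)"
  shows "\<rho> * cmod (of_real (1 - t) * x + of_real t * y)
           < cmod (1 + a * (of_real (1 - t) * x + of_real t * y))"
proof -
  define q where "q v = (cmod (1 + a * v))\<^sup>2 - (\<rho> * cmod v)\<^sup>2" for v
  have rho: "0 \<le> \<rho>"
    using a norm_ge_zero[of a] by linarith
  have q_pos: "0 < q v \<longleftrightarrow> \<rho> * cmod v < cmod (1 + a * v)" for v
  proof -
    have "0 < q v \<longleftrightarrow> (\<rho> * cmod v)\<^sup>2 < (cmod (1 + a * v))\<^sup>2"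
      by (simp add: q_def)
    also have "\<dots> \<longleftrightarrow> \<rho> * cmod v < cmod (1 + a * v)"
      using rho by (simp add: power_mono_iff linorder_not_le[symmetric])
    finally show ?thesis .
  qed
  have interpolate: "q (of_real (1 - t) * x + of_real t * y)
      = (1 - t) * q x + t * q y + (\<rho>\<^sup>2 - (cmod a)\<^sup>2) * (t * (1 - t)) * (cmod (x - y))\<^sup>2"
    unfolding q_def power_mult_distrib cmod_power2
    by (simp add: algebra_simps power2_eq_square)
  have "(cmod a)\<^sup>2 \<le> \<rho>\<^sup>2"
    using a by (simp add: power_mono)
  then have rest: "0 \<le> (\<rho>\<^sup>2 - (cmod a)\<^sup>2) * (t * (1 - t)) * (cmod (x - y))\<^sup>2"
    using t by simp
  have "0 < (1 - t) * q x + t * q y"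
  proof (cases "t = 0")
    case True
    then show ?thesis using x q_pos by simp
  next
    case False
    then have "0 < t * q y"
      using t y q_pos by simp
    moreover have "0 \<le> (1 - t) * q x"
      using t x q_pos[of x] by simp
    ultimately show ?thesis by linarith
  qed
  with rest interpolate have "0 < q (of_real (1 - t) * x + of_real t * y)"
    by linarith
  then show ?thesis using q_pos by blast
qed

text \<open>
  The point \<open>y\<close> is the average of the numbers \<open>1 / (\<zeta> - u)\<close> over the zeros \<open>\<zeta>\<close> of \<open>p\<close>, padded
  with zeros to \<open>n\<close> summands when the degree is smaller than \<open>n\<close>; padding amounts
  to placing the missing zeros at infinity.
\<close>
lemma log_derivative_in_inverted_exterior:
  fixes p :: "complex poly" and c u :: complex and \<rho> :: real
  assumes "degree p \<le> n"
    and "\<And>x. cmod (x - c) \<le> \<rho> \<Longrightarrow> poly p x \<noteq> 0"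
    and u: "cmod (u - c) \<le> \<rho>"
  shows "\<exists>y. \<rho> * cmod y < cmod (1 + (u - c) * y) \<and>
             - poly (pderiv p) u = of_nat n * y * poly p u"
  using assms(1,2)
proof (induction n arbitrary: p)
  case 0
  then have "pderiv p = 0"
    by (simp add: pderiv_eq_0_iff)
  then show ?case
    by (intro exI[of _ 0]) simp
next
  case (Suc n)
  show ?case
  proof (cases "degree p = 0")
    case True
    then have "pderiv p = 0"
      by (simp add: pderiv_eq_0_iff)
    then show ?thesis
      by (intro exI[of _ 0]) simp
  next
    case False
    then have "\<not> constant (poly p)"
      by (simp add: constant_degree)
    then obtain \<zeta> where "poly p \<zeta> = 0"
      using fundamental_theorem_of_algebra by blast
    then obtain q where p: "p = [:- \<zeta>, 1:] * q"
      using poly_eq_0_iff_dvd by (metis dvdE)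
    have outside: "\<rho> < cmod (\<zeta> - c)"
      using Suc.prems(2)[of \<zeta>] \<open>poly p \<zeta> = 0\<close> by fastforce
    then have "u \<noteq> \<zeta>"
      using u by auto
    have "q \<noteq> 0"
      using p False by auto
    then have "degree p = Suc (degree q)"
      unfolding p by (subst degree_mult_eq) auto
    then have "degree q \<le> n"
      using Suc.prems(1) by simp
    moreover have "poly q x \<noteq> 0" if "cmod (x - c) \<le> \<rho>" for x
      using Suc.prems(2)[OF that] p by auto
    ultimately obtain y
      where y: "\<rho> * cmod y < cmod (1 + (u - c) * y)"
        and dq: "- poly (pderiv q) u = of_nat n * y * poly q u"
      using Suc.IH by blast
    define x where "x = 1 / (\<zeta> - u)"
    have x: "\<rho> * cmod x < cmod (1 + (u - c) * x)"
    proof -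
      have "1 + (u - c) * x = (\<zeta> - c) * x"
        using \<open>u \<noteq> \<zeta>\<close> by (simp add: x_def field_simps)
      moreover have "0 < cmod x"
        using \<open>u \<noteq> \<zeta>\<close> by (simp add: x_def)
      ultimately show ?thesis
        using outside by (simp add: norm_mult)
    qed
    define t where "t = 1 / real (Suc n)"
    define v where "v = of_real (1 - t) * y + of_real t * x"
    have "\<rho> * cmod v < cmod (1 + (u - c) * v)"
      unfolding v_def
      by (rule inverted_exterior_convex[OF u _ _ y x]) (auto simp: t_def)
    moreover have "- poly (pderiv p) u = of_nat (Suc n) * v * poly p u"
    proof -
      have v: "of_nat (Suc n) * v = of_nat n * y + x"
      proof -
        have 1: "of_nat (Suc n) * complex_of_real t = 1"
          by (simp add: t_def del: of_nat_Suc)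
        have "of_nat (Suc n) * v
            = of_nat (Suc n) * y + (of_nat (Suc n) * complex_of_real t) * (x - y)"
          by (simp add: v_def algebra_simps del: of_nat_Suc)
        then show ?thesis
          unfolding 1 by (simp add: algebra_simps)
      qed
      have xu: "x * (u - \<zeta>) = - 1"
        using \<open>u \<noteq> \<zeta>\<close> by (simp add: x_def field_simps)
      have pu: "poly p u = (u - \<zeta>) * poly q u"
        by (simp add: p algebra_simps)
      have "- poly (pderiv p) u = - poly q u + (u - \<zeta>) * (- poly (pderiv q) u)"
        unfolding p pderiv_mult by (simp add: pderiv_pCons algebra_simps)
      also have "\<dots> = x * (u - \<zeta>) * poly q u + (u - \<zeta>) * (of_nat n * y * poly q u)"
        unfolding dq xu by simp
      also have "\<dots> = of_nat (Suc n) * v * poly p u"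
        unfolding v pu by (simp add: algebra_simps)
      finally show ?thesis .
    qed
    ultimately show ?thesis by blast
  qed
qed

text \<open>
  If the polar derivative vanished at \<open>u\<close>, the average from the preceding lemma would be \<open>1 / (w - u)\<close>,
  the inversion of a point \<open>w\<close> of the disc.
\<close>
theorem laguerre_polar_derivative:
  fixes p :: "complex poly" and c u w :: complex and \<rho> :: real
  assumes deg: "degree p \<le> n" and n: "0 < n"
    and no_zero: "\<And>x. cmod (x - c) \<le> \<rho> \<Longrightarrow> poly p x \<noteq> 0"
    and u: "cmod (u - c) \<le> \<rho>" and w: "cmod (w - c) \<le> \<rho>"
  shows "of_nat n * poly p u + (w - u) * poly (pderiv p) u \<noteq> 0"
proof
  assume zero: "of_nat n * poly p u + (w - u) * poly (pderiv p) u = 0"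
  obtain y where y: "\<rho> * cmod y < cmod (1 + (u - c) * y)"
    and dp: "- poly (pderiv p) u = of_nat n * y * poly p u"
    using log_derivative_in_inverted_exterior[OF deg no_zero u] by blast
  have "of_nat n * poly p u * (1 - (w - u) * y) = of_nat n * poly p u + (w - u) * poly (pderiv p) u"
    using arg_cong[OF dp, of "\<lambda>d. (w - u) * d"] by (simp add: algebra_simps)
  then have "(w - u) * y = 1"
    using zero n no_zero[OF u] by simp
  then have "1 + (u - c) * y = (w - c) * y"
    by (simp add: algebra_simps)
  then show False
    using y w mult_right_mono[OF w norm_ge_zero[of y]] by (simp add: norm_mult)
qed

section \<open>Walsh's coincidence principle\<close>

text \<open>
  This is the polynomial in \<open>z - \<alpha>\<close> to which the functional \<open>\<Sum>k\<le>n. \<mu> k * f\<^sup>(\<^sup>k\<^sup>)(z) / k!\<close> reduces when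
  \<open>f = (x - \<alpha>)\<^sup>n\<close>.  For fixed \<open>\<mu>\<close> these polynomials form an Appell sequence.
\<close>
definition appell_poly :: "nat \<Rightarrow> (nat \<Rightarrow> complex) \<Rightarrow> complex poly" where
  "appell_poly n \<mu> = (\<Sum>k\<le>n. monom (of_nat (n choose k) * \<mu> k) (n - k))"

lemma poly_appell: "poly (appell_poly n \<mu>) y = (\<Sum>k\<le>n. of_nat (n choose k) * \<mu> k * y ^ (n - k))"
  by (simp add: appell_poly_def poly_sum poly_monom)

lemma degree_appell: "degree (appell_poly n \<mu>) \<le> n"
  unfolding appell_poly_def
  by (rule degree_sum_le) (auto intro: order_trans[OF degree_monom_le])

lemma pderiv_appell: "pderiv (appell_poly (Suc n) \<mu>) = smult (of_nat (Suc n)) (appell_poly n \<mu>)"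
proof (rule poly_eqI)
  fix j
  have summand: "of_nat (Suc j) * coeff (monom (of_nat (Suc n choose k) * \<mu> k) (Suc n - k)) (Suc j)
      = of_nat (Suc n) * coeff (monom (of_nat (n choose k) * \<mu> k) (n - k)) j" if "k \<le> n" for k
  proof (cases "n - k = j")
    case True
    have "Suc j * (Suc n choose k) = Suc n * (n choose k)"
      using binomial_absorb_comp[of "Suc n" k] True that by (simp add: Suc_diff_le)
    then have "of_nat (Suc j) * of_nat (Suc n choose k) = (of_nat (Suc n) * of_nat (n choose k) :: complex)"
      by (metis of_nat_mult)
    then show ?thesis
      using True that by (simp add: Suc_diff_le mult.assoc[symmetric] del: of_nat_Suc binomial_Suc_Suc)
  next
    case False
    then show ?thesis
      using that by (simp add: Suc_diff_le)
  qed
  have last: "of_nat (Suc j) * coeff (monom b (Suc n - Suc n)) (Suc j) = 0" for b :: complex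
    by simp
  show "coeff (pderiv (appell_poly (Suc n) \<mu>)) j
      = coeff (smult (of_nat (Suc n)) (appell_poly n \<mu>)) j"
    unfolding appell_poly_def coeff_pderiv coeff_smult coeff_sum sum_distrib_left
    by (simp only: sum.atMost_Suc last add_0_right) (intro sum.cong refl summand; simp)
qed

lemma poly_appell_Suc:
  "poly (appell_poly (Suc n) \<mu>) y
     = y * poly (appell_poly n \<mu>) y + poly (appell_poly n (\<lambda>k. \<mu> (Suc k))) y"
proof -
  have "poly (appell_poly (Suc n) \<mu>) y
      = \<mu> 0 * y ^ Suc n + (\<Sum>k\<le>n. of_nat (n choose Suc k) * \<mu> (Suc k) * y ^ (n - k))
        + (\<Sum>k\<le>n. of_nat (n choose k) * \<mu> (Suc k) * y ^ (n - k))"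
    unfolding poly_appell
    by (subst sum.atMost_Suc_shift) (simp add: algebra_simps sum.distrib)
  also have "\<mu> 0 * y ^ Suc n + (\<Sum>k\<le>n. of_nat (n choose Suc k) * \<mu> (Suc k) * y ^ (n - k))
      = (\<Sum>k\<le>Suc n. of_nat (n choose k) * \<mu> k * y ^ (Suc n - k))"
    by (subst sum.atMost_Suc_shift) simp
  also have "\<dots> = y * poly (appell_poly n \<mu>) y"
    unfolding poly_appell
    by (simp add: sum_distrib_left Suc_diff_le mult_ac)
  finally show ?thesis
    unfolding poly_appell .
qed

text \<open>
  Splitting off from \<open>f\<close> the zero \<open>z - \<beta>\<close> changes the coefficients \<open>\<mu> k\<close> to
  \<open>\<beta> * \<mu> k + \<mu> (Suc k)\<close>; on the Appell polynomial this is the polar derivative with pole \<open>\<beta>\<close>.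
\<close>
lemma appell_polar_derivative:
  "of_nat (Suc n) * poly (appell_poly n (\<lambda>k. \<beta> * \<mu> k + \<mu> (Suc k))) y
     = of_nat (Suc n) * poly (appell_poly (Suc n) \<mu>) y
       + (\<beta> - y) * poly (pderiv (appell_poly (Suc n) \<mu>)) y"
proof -
  have "poly (appell_poly n (\<lambda>k. \<beta> * \<mu> k + \<mu> (Suc k))) y
      = \<beta> * poly (appell_poly n \<mu>) y + poly (appell_poly n (\<lambda>k. \<mu> (Suc k))) y"
    unfolding poly_appell by (simp add: sum_distrib_left sum.distrib algebra_simps)
  then show ?thesis
    unfolding poly_appell_Suc pderiv_appell by (simp add: algebra_simps del: of_nat_Suc)
qed

lemma higher_pderiv_linear_factor:
  "(pderiv ^^ Suc k) ([:- \<alpha>, 1:] * q)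
     = [:- \<alpha>, 1:] * (pderiv ^^ Suc k) q + smult (of_nat (Suc k)) ((pderiv ^^ k) q)"
  for q :: "complex poly"
proof (induction k)
  case 0
  have "pderiv [:- \<alpha>, 1:] = 1"
    by (simp add: pderiv_pCons)
  then show ?case
    by (simp only: funpow.simps comp_def id_apply pderiv_mult) simp
next
  case (Suc k)
  have "(pderiv ^^ Suc (Suc k)) ([:- \<alpha>, 1:] * q)
      = pderiv ([:- \<alpha>, 1:] * (pderiv ^^ Suc k) q + smult (of_nat (Suc k)) ((pderiv ^^ k) q))"
    using Suc by simp
  also have "\<dots> = [:- \<alpha>, 1:] * pderiv ((pderiv ^^ Suc k) q) + (pderiv ^^ Suc k) q
      + smult (of_nat (Suc k)) ((pderiv ^^ Suc k) q)"
    unfolding pderiv_add pderiv_mult pderiv_smult by (simp add: pderiv_pCons del: of_nat_Suc)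
  also have "\<dots> = [:- \<alpha>, 1:] * (pderiv ^^ Suc (Suc k)) q
      + smult (of_nat (Suc (Suc k))) ((pderiv ^^ Suc k) q)"
    by (subst of_nat_Suc[of "Suc k"]) (simp add: smult_add_left del: of_nat_Suc)
  finally show ?case .
qed

lemma taylor_functional_linear_factor:
  fixes q :: "complex poly" and \<mu> :: "nat \<Rightarrow> complex"
  assumes deg: "degree q \<le> n"
  shows "(\<Sum>k\<le>Suc n. \<mu> k * poly ((pderiv ^^ k) ([:- \<alpha>, 1:] * q)) z / fact k)
       = (\<Sum>k\<le>n. ((z - \<alpha>) * \<mu> k + \<mu> (Suc k)) * poly ((pderiv ^^ k) q) z / fact k)"
proof -
  define a where "a k = poly ((pderiv ^^ k) q) z / fact k" for k
  define b where "b k = poly ((pderiv ^^ k) ([:- \<alpha>, 1:] * q)) z / fact k" for k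
  have b0: "b 0 = (z - \<alpha>) * a 0"
    by (simp add: a_def b_def algebra_simps)
  have bS: "b (Suc k) = (z - \<alpha>) * a (Suc k) + a k" for k
  proof -
    have "b (Suc k) = (z - \<alpha>) * a (Suc k)
        + of_nat (Suc k) * poly ((pderiv ^^ k) q) z / fact (Suc k)"
      unfolding b_def a_def higher_pderiv_linear_factor
      by (simp add: add_divide_distrib diff_divide_distrib algebra_simps del: fact_Suc of_nat_Suc funpow.simps)
    moreover have "of_nat (Suc k) * poly ((pderiv ^^ k) q) z / fact (Suc k) = a k"
      unfolding a_def fact_Suc by (simp del: of_nat_Suc)
    ultimately show ?thesis by simp
  qed
  have top: "a (Suc n) = 0"
  proof -
    have "degree ((pderiv ^^ n) q) = 0"
      using deg by (simp add: degree_higher_pderiv)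
    then have "(pderiv ^^ Suc n) q = 0"
      by (simp add: pderiv_eq_0_iff)
    then show ?thesis by (simp add: a_def)
  qed
  have expand: "\<mu> (Suc k) * b (Suc k) = \<mu> (Suc k) * ((z - \<alpha>) * a (Suc k)) + \<mu> (Suc k) * a k" for k
    by (simp add: bS distrib_left)
  have "(\<Sum>k\<le>Suc n. \<mu> k * b k)
      = (\<mu> 0 * ((z - \<alpha>) * a 0) + (\<Sum>k\<le>n. \<mu> (Suc k) * ((z - \<alpha>) * a (Suc k))))
        + (\<Sum>k\<le>n. \<mu> (Suc k) * a k)"
    by (subst sum.atMost_Suc_shift) (simp add: b0 expand sum.distrib)
  also have "\<mu> 0 * ((z - \<alpha>) * a 0) + (\<Sum>k\<le>n. \<mu> (Suc k) * ((z - \<alpha>) * a (Suc k)))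
      = (\<Sum>k\<le>Suc n. \<mu> k * ((z - \<alpha>) * a k))"
    by (subst sum.atMost_Suc_shift) simp
  also have "\<dots> = (\<Sum>k\<le>n. \<mu> k * ((z - \<alpha>) * a k))"
    by (simp add: top)
  also have "\<dots> + (\<Sum>k\<le>n. \<mu> (Suc k) * a k) = (\<Sum>k\<le>n. ((z - \<alpha>) * \<mu> k + \<mu> (Suc k)) * a k)"
    by (simp add: sum.distrib[symmetric] algebra_simps)
  finally show ?thesis
    unfolding a_def b_def times_divide_eq_right .
qed

text \<open>
  Laguerre's theorem is applied in the variable \<open>y = z - x\<close>, in which the disc has centre \<open>z - c\<close>.
\<close>
theorem walsh_coincidence:
  fixes f :: "complex poly" and \<mu> :: "nat \<Rightarrow> complex" and c z :: complex and \<rho> :: real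
  assumes "degree f = n" and "f \<noteq> 0"
    and "\<And>x. poly f x = 0 \<Longrightarrow> cmod (x - c) \<le> \<rho>"
    and "\<And>x. cmod (x - c) \<le> \<rho> \<Longrightarrow> (\<Sum>k\<le>n. of_nat (n choose k) * \<mu> k * (z - x) ^ (n - k)) \<noteq> 0"
    and "0 \<le> \<rho>"
  shows "(\<Sum>k\<le>n. \<mu> k * poly ((pderiv ^^ k) f) z / fact k) \<noteq> 0"
  using assms(1-4)
proof (induction n arbitrary: f \<mu>)
  case 0
  have "\<mu> 0 \<noteq> 0"
    using 0(4)[of c] \<open>0 \<le> \<rho>\<close> by simp
  moreover obtain b where "f = [:b:]"
    using 0(1) degree_eq_zeroE by blast
  ultimately show ?case
    using 0(2) by simp
next
  case (Suc n)
  have "\<not> constant (poly f)"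
    using Suc.prems(1) by (simp add: constant_degree)
  then obtain \<alpha> where \<alpha>: "poly f \<alpha> = 0"
    using fundamental_theorem_of_algebra by blast
  then obtain q where f: "f = [:- \<alpha>, 1:] * q"
    using poly_eq_0_iff_dvd by (metis dvdE)
  have "q \<noteq> 0"
    using f Suc.prems(2) by auto
  then have "degree f = Suc (degree q)"
    unfolding f by (subst degree_mult_eq) auto
  then have deg: "degree q = n"
    using Suc.prems(1) by simp
  define \<nu> where "\<nu> k = (z - \<alpha>) * \<mu> k + \<mu> (Suc k)" for k
  have flip: "cmod (y - (z - c)) = cmod ((z - y) - c)" for y
    using norm_minus_commute[of y "z - c"] by (simp add: algebra_simps)
  have no_zero: "poly (appell_poly (Suc n) \<mu>) y \<noteq> 0" if "cmod (y - (z - c)) \<le> \<rho>" for y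
    using Suc.prems(4)[of "z - y"] that by (simp only: poly_appell flip) simp
  have "(\<Sum>k\<le>n. \<nu> k * poly ((pderiv ^^ k) q) z / fact k) \<noteq> 0"
  proof (rule Suc.IH[OF deg \<open>q \<noteq> 0\<close>])
    show "cmod (x - c) \<le> \<rho>" if "poly q x = 0" for x
      using Suc.prems(3)[of x] that f by simp
  next
    fix x assume x: "cmod (x - c) \<le> \<rho>"
    have u: "cmod ((z - x) - (z - c)) \<le> \<rho>"
      using x by (simp only: flip) simp
    have w: "cmod ((z - \<alpha>) - (z - c)) \<le> \<rho>"
      using Suc.prems(3)[OF \<alpha>] by (simp only: flip) simp
    have "of_nat (Suc n) * poly (appell_poly n \<nu>) (z - x) \<noteq> 0"
      unfolding \<nu>_def appell_polar_derivative
      by (rule laguerre_polar_derivative[OF degree_appell _ no_zero u w]) simp_all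
    then show "(\<Sum>k\<le>n. of_nat (n choose k) * \<nu> k * (z - x) ^ (n - k)) \<noteq> 0"
      by (simp add: poly_appell del: of_nat_Suc)
  qed
  then show ?case
    unfolding f \<nu>_def using taylor_functional_linear_factor[of q n \<mu> \<alpha> z] deg by simp
qed

section \<open>Location of the zeros of the composed polynomial\<close>

theorem theorem1p1:
  fixes m n :: nat
    and lam :: "nat \<Rightarrow> complex"
    and \<sigma> :: complex
    and r s :: real
    and f g h :: "complex poly"
  assumes "m \<le> n"
    and "degree f = n"
    and "\<forall>z. poly f z = 0 \<longrightarrow> cmod z \<le> r"
    and "g = (\<Sum>k\<le>m. monom (of_nat (n choose k) * lam k) k)"
    and "s > 0"
    and "\<forall>z. poly g z = 0 \<longrightarrow> cmod z \<le> s * cmod (z - \<sigma>)"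
    and "h = (\<Sum>k\<le>m. smult (lam k / fact k) ((pderiv ^^ k) f * [:0, \<sigma>:] ^ k))"
    and nondegenerate: "\<not> (\<sigma> = 0 \<and> lam 0 = 0)"
  shows "\<forall>z. poly h z = 0 \<longrightarrow> cmod z \<le> r * max 1 s"
proof (intro allI impI)
  fix z assume hz: "poly h z = 0"
  have "f \<noteq> 0"
    using assms(3)[rule_format, of "of_real (\<bar>r\<bar> + 1)"] by (auto simp del: of_real_add)
  define \<mu> where "\<mu> k = (if k \<le> m then lam k * (\<sigma> * z) ^ k else 0)" for k
  have extend: "(\<Sum>k\<le>n. \<mu> k * b k) = (\<Sum>k\<le>m. lam k * (\<sigma> * z) ^ k * b k)" for b
    using assms(1) by (intro sum.mono_neutral_cong_right) (auto simp: \<mu>_def)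
  have "poly h z = (\<Sum>k\<le>m. lam k * (\<sigma> * z) ^ k * (poly ((pderiv ^^ k) f) z / fact k))"
    unfolding assms(7) by (simp add: poly_sum mult_ac)
  also have "\<dots> = (\<Sum>k\<le>n. \<mu> k * (poly ((pderiv ^^ k) f) z / fact k))"
    by (rule extend[symmetric])
  also have "\<dots> = (\<Sum>k\<le>n. \<mu> k * poly ((pderiv ^^ k) f) z / fact k)"
    by simp
  finally have hz': "(\<Sum>k\<le>n. \<mu> k * poly ((pderiv ^^ k) f) z / fact k) = 0"
    using hz by simp
  have poly_g: "poly g w = (\<Sum>k\<le>m. of_nat (n choose k) * lam k * w ^ k)" for w
    by (simp add: assms(4) poly_sum poly_monom)
  have pole: "poly g \<sigma> \<noteq> 0" if "\<sigma> \<noteq> 0"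
    using assms(6) that by fastforce
  show "cmod z \<le> r * max 1 s"
  proof (cases "n = 0")
    case True
    (* A constant f has no zeros, so r may be negative here; h must be shown to have no zeros. *)
    then have m: "m = 0"
      using assms(1) by simp
    obtain b where "f = [:b:]"
      using True assms(2) degree_eq_zeroE by blast
    then have fz: "poly f z \<noteq> 0"
      using \<open>f \<noteq> 0\<close> by simp
    have "lam 0 \<noteq> 0"
      using pole nondegenerate m by (auto simp: poly_g)
    then show ?thesis
      using hz fz m by (simp add: assms(7))
  next
    case False
    then have "\<not> constant (poly f)"
      using assms(2) by (simp add: constant_degree)
    then obtain \<zeta> where "poly f \<zeta> = 0"
      using fundamental_theorem_of_algebra by blast
    then have r: "0 \<le> r"
      using assms(3) norm_ge_zero order_trans by blast
    show ?thesis
    proof (rule ccontr)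
      assume "\<not> cmod z \<le> r * max 1 s"
      then have big: "r * max 1 s < cmod z" by simp
      moreover have "r * 1 \<le> r * max 1 s" "r * s \<le> r * max 1 s"
        by (rule mult_left_mono[OF _ r]; simp)+
      ultimately have zr: "r < cmod z" and zs: "r * s < cmod z"
        by linarith+
      have "(\<Sum>k\<le>n. \<mu> k * poly ((pderiv ^^ k) f) z / fact k) \<noteq> 0"
      proof (rule walsh_coincidence[OF assms(2) \<open>f \<noteq> 0\<close> _ _ r, where c = 0])
        show "cmod (x - 0) \<le> r" if "poly f x = 0" for x
          using assms(3) that by simp
      next
        fix \<alpha> assume "cmod (\<alpha> - 0) \<le> r"
        then have \<alpha>: "cmod \<alpha> \<le> r" by simp
        then have ne: "z - \<alpha> \<noteq> 0"
          using zr by auto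
        define w where "w = \<sigma> * z / (z - \<alpha>)"
        have "(z - \<alpha>) ^ n * poly g w
            = (\<Sum>k\<le>m. lam k * (\<sigma> * z) ^ k * (of_nat (n choose k) * (z - \<alpha>) ^ (n - k)))"
          unfolding poly_g sum_distrib_left
        proof (rule sum.cong)
          fix k assume "k \<in> {..m}"
          then have split: "(z - \<alpha>) ^ n = (z - \<alpha>) ^ (n - k) * (z - \<alpha>) ^ k"
            using assms(1) by (simp add: power_add[symmetric])
          have scale: "(\<sigma> * z) ^ k = (z - \<alpha>) ^ k * w ^ k"
            using ne by (simp add: w_def power_mult_distrib[symmetric])
          show "(z - \<alpha>) ^ n * (of_nat (n choose k) * lam k * w ^ k)
              = lam k * (\<sigma> * z) ^ k * (of_nat (n choose k) * (z - \<alpha>) ^ (n - k))"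
            unfolding split scale by (simp only: mult_ac)
        qed simp
        also have "\<dots> = (\<Sum>k\<le>n. of_nat (n choose k) * \<mu> k * (z - \<alpha>) ^ (n - k))"
          unfolding extend[symmetric] by (simp add: mult_ac)
        finally have eq: "(z - \<alpha>) ^ n * poly g w
            = (\<Sum>k\<le>n. of_nat (n choose k) * \<mu> k * (z - \<alpha>) ^ (n - k))" .
        have "poly g w \<noteq> 0"
        proof (cases "\<sigma> = 0")
          case True
          then have "poly g w = lam 0"
            by (simp add: poly_g w_def power_0_left if_distrib cong: if_cong)
          then show ?thesis
            using nondegenerate True by simp
        next
          case False
          show ?thesis
          proof
            assume "poly g w = 0"
            then have le: "cmod w \<le> s * cmod (w - \<sigma>)"
              using assms(6) by simp
            have "w - \<sigma> = \<sigma> * \<alpha> / (z - \<alpha>)"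
              using ne by (simp add: w_def field_simps)
            then have "cmod \<sigma> / cmod (z - \<alpha>) * cmod z
                \<le> cmod \<sigma> / cmod (z - \<alpha>) * (s * cmod \<alpha>)"
              using le by (simp add: w_def norm_mult norm_divide mult_ac)
            then have "cmod z \<le> s * cmod \<alpha>"
              using False ne by (subst (asm) mult_le_cancel_left_pos) simp_all
            also have "\<dots> \<le> r * s"
              using \<alpha> assms(5) by (simp add: mult.commute)
            finally show False
              using zs by simp
          qed
        qed
        then show "(\<Sum>k\<le>n. of_nat (n choose k) * \<mu> k * (z - \<alpha>) ^ (n - k)) \<noteq> 0"
          using ne by (simp flip: eq)
      qed
      then show False
        using hz' by simp
    qed
  qed
qed

end
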